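(* Let $X$ and $Y$ be Hilbert spaces, $f:X\to[-\infty,+\infty]$ a proper function, $y_0\in Y$, and $p:X\times Y\to[-\infty,+\infty]$ a function with $p(x,y_0)=f(x)$ for all $x\in X$. Assume that $p(x,\cdot)$ is $\Psi_{lsc}$-convex at $y_0$ for all $x\in X$. Let $\mathcal{L}:X\times\Psi_{lsc}\to[-\infty,+\infty]$ be given by $\mathcal{L}(x,\psi)=\psi(y_0)-\sup_{y\in Y}\{\psi(y)-p(x,y)\}$. If the optimal value function $V:Y\to[-\infty,+\infty]$, $V(y)=\inf_{x\in X}p(x,y)$, is proper, lower semicontinuous and paraconvex on $Y$, and $y_0\in\operatorname{int}\operatorname{dom}(V)$, then $$\inf_{x\in X} f(x)=\sup_{\psi\in\Psi_{lsc}}\inf_{x\in X}\mathcal{L}(x,\psi)=\inf_{x\in X}\sup_{\psi\in\Psi_{lsc}}\mathcal{L}(x,\psi),$$ and the solution set of the dual problem $\sup_{\psi\in\Psi_{lsc}}\inf_{x\in X}\mathcal{L}(x,\psi)$ is nonempty and coincides with $\partial_{lsc}V(y_0)$.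
   Context: Hilbert spaces are real. $\operatorname{dom}h=\{h<+\infty\}$; $h$ is proper if $\operatorname{dom}h\ne\emptyset$ and $h>-\infty$ everywhere. $\Psi_{lsc}$ is the set of all functions $\psi:Y\to\mathbb{R}$, $\psi(y)=-a\|y\|^2+\langle v,y\rangle+c$, with $a\ge 0$, $v\in Y$ ($Y^*$ identified with $Y$), $c\in\mathbb{R}$. A function $h:Y\to[-\infty,+\infty]$ is $\Psi_{lsc}$-convex at $y_0$ if $h(y_0)=\sup\{\psi(y_0):\psi\in\Psi_{lsc},\ \psi\le h\text{ on }Y\}$ ($\sup\emptyset=-\infty$). A function $h:Y\to\mathbb{R}\cup\{+\infty\}$ is paraconvex on $Y$ if there exists $c>0$ such that $h+c\|\cdot\|^2$ is convex. For $h:Y\to[-\infty,+\infty]$ and $\bar y\in\operatorname{dom}h$, $\partial_{lsc}h(\bar y)$ is the set of all $(a,v)\in[0,\infty)\times Y$ such that $h(y)-h(\bar y)\ge\langle v,y-\bar y\rangle-a\|y\|^2+a\|\bar y\|^2$ for all $y\in Y$. A solution of the dual problem is an element $\psi_0\in\Psi_{lsc}$ with $\inf_{x\in X}\mathcal{L}(x,\psi_0)=\sup_{\psi\in\Psi_{lsc}}\inf_{x\in X}\mathcal{L}(x,\psi)$. The value $\mathcal{L}(x,\psi)$ does not depend on the constant $c$ in $\psi$, so $\mathcal{L}$ is regarded as a function of $(x,a,v)\in X\times[0,\infty)\times Y$, and solutions $\psi_0(y)=-a\|y\|^2+\langle v,y\rangle+c$ are identified with the pairs $(a,v)$; with this identification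 the solution set is compared to $\partial_{lsc}V(y_0)$. *)

theory Defs
  imports "HOL-Analysis.Analysis"
begin

definition effective_domain :: "('a \<Rightarrow> ereal) \<Rightarrow> 'a set" where
  "effective_domain h = {y. h y < \<infinity>}"

definition proper_fun :: "('a \<Rightarrow> ereal) \<Rightarrow> bool" where
  "proper_fun h \<longleftrightarrow> effective_domain h \<noteq> {} \<and> (\<forall>y. h y > -\<infinity>)"

definition lower_semicontinuous :: "('a::topological_space \<Rightarrow> ereal) \<Rightarrow> bool" where
  "lower_semicontinuous h \<longleftrightarrow> (\<forall>y. h y \<le> Liminf (at y) h)"

(* Used only for functions that never take the value -\<infinity>, so that no sum
   \<infinity> + (-\<infinity>) arises; in ereal, 0 * \<infinity> = 0. *)
definition ereal_convex :: "('a::real_vector \<Rightarrow> ereal) \<Rightarrow> bool" where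
  "ereal_convex h \<longleftrightarrow>
     (\<forall>x y. \<forall>u\<ge>0. \<forall>v\<ge>0. u + v = 1 \<longrightarrow>
        h (u *\<^sub>R x + v *\<^sub>R y) \<le> ereal u * h x + ereal v * h y)"

definition paraconvex :: "('a::real_normed_vector \<Rightarrow> ereal) \<Rightarrow> bool" where
  "paraconvex h \<longleftrightarrow> (\<forall>y. h y > -\<infinity>) \<and>
     (\<exists>c>0. ereal_convex (\<lambda>y. h y + ereal (c * (norm y)\<^sup>2)))"

definition psi_fun :: "real \<Rightarrow> 'a::real_inner \<Rightarrow> real \<Rightarrow> 'a \<Rightarrow> real" where
  "psi_fun a v c = (\<lambda>y. - a * (norm y)\<^sup>2 + inner v y + c)"

definition Psi_lsc :: "('a::real_inner \<Rightarrow> real) set" where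
  "Psi_lsc = {psi_fun a v c |a v c. a \<ge> 0}"

(* In ereal, Sup {} = -\<infinity>. *)
definition Psi_lsc_convex_at :: "('a::real_inner \<Rightarrow> ereal) \<Rightarrow> 'a \<Rightarrow> bool" where
  "Psi_lsc_convex_at h y0 \<longleftrightarrow>
     h y0 = Sup {ereal (\<psi> y0) |\<psi>. \<psi> \<in> Psi_lsc \<and> (\<forall>y. ereal (\<psi> y) \<le> h y)}"

(* Only meaningful where h is finite at y0. *)
definition subdiff_lsc :: "('a::real_inner \<Rightarrow> ereal) \<Rightarrow> 'a \<Rightarrow> (real \<times> 'a) set" where
  "subdiff_lsc h y0 =
     {(a, v). a \<ge> 0 \<and>
        (\<forall>y. h y - h y0 \<ge> ereal (inner v (y - y0) - a * (norm y)\<^sup>2 + a * (norm y0)\<^sup>2))}"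

definition optimal_value :: "('a \<Rightarrow> 'b \<Rightarrow> ereal) \<Rightarrow> 'b \<Rightarrow> ereal" where
  "optimal_value p y = (INF x. p x y)"

(* As \<psi> is real valued, no difference of infinities arises. *)
definition lagrangian :: "('a \<Rightarrow> 'b \<Rightarrow> ereal) \<Rightarrow> 'b \<Rightarrow> 'a \<Rightarrow> ('b \<Rightarrow> real) \<Rightarrow> ereal" where
  "lagrangian p y0 x \<psi> = ereal (\<psi> y0) - (SUP y. ereal (\<psi> y) - p x y)"

definition dual_solutions :: "('a \<Rightarrow> 'b::real_inner \<Rightarrow> ereal) \<Rightarrow> 'b \<Rightarrow> ('b \<Rightarrow> real) set" where
  "dual_solutions p y0 =
     {\<psi>0 \<in> Psi_lsc.
        (INF x. lagrangian p y0 x \<psi>0) = (SUP \<psi>\<in>Psi_lsc. INF x. lagrangian p y0 x \<psi>)}"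

(* The Lagrangian does not depend on the additive constant of \<psi>, see
   lagrangian_psi_fun_const below, so solutions are identified with pairs (a, v). *)
definition dual_solution_pairs :: "('a \<Rightarrow> 'b::real_inner \<Rightarrow> ereal) \<Rightarrow> 'b \<Rightarrow> (real \<times> 'b) set" where
  "dual_solution_pairs p y0 = {(a, v). a \<ge> 0 \<and> (\<exists>c. psi_fun a v c \<in> dual_solutions p y0)}"

lemma lagrangian_psi_fun_const:
  "lagrangian p y0 x (psi_fun a v c) = lagrangian p y0 x (psi_fun a v 0)"
proof -
  have shift: "ereal (psi_fun a v c y) - p x y = ereal c + (ereal (psi_fun a v 0 y) - p x y)" for y
    by (cases "p x y") (auto simp: psi_fun_def)
  have "(SUP y. ereal (psi_fun a v c y) - p x y) =
        ereal c + (SUP y. ereal (psi_fun a v 0 y) - p x y)"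
    unfolding shift by (rule SUP_ereal_add_right) auto
  then show ?thesis
    unfolding lagrangian_def
    by (cases "SUP y. ereal (psi_fun a v 0 y) - p x y") (auto simp: psi_fun_def)
qed

end

theory Submission
  imports Defs
begin

text \<open>
  For \<open>c\<close> as in paraconvexity, \<open>g = V + c \<parallel>\<cdot>\<parallel>\<^sup>2\<close> is convex and lower semicontinuous, so a subgradient
  \<open>v\<close> of \<open>g\<close> at \<open>y0\<close> gives the element \<open>(c, v)\<close> of the \<open>lsc\<close>-subdifferential of \<open>V\<close>. The
  subgradient is found without the Hahn-Banach theorem. By Baire's theorem \<open>g\<close> is bounded above
  near \<open>y0\<close>, whence \<open>g y \<ge> g y0 - m \<parallel>y - y0\<parallel>\<close> on the whole domain. The minimisers \<open>w\<^sub>k\<close> of the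
  Moreau envelopes \<open>g + k/2 \<parallel>\<cdot> - y0\<parallel>\<^sup>2\<close> then exist, the vectors \<open>k (y0 - w\<^sub>k)\<close> are subgradients at
  \<open>w\<^sub>k\<close> of norm at most \<open>m\<close>, and monotonicity of the subdifferential makes them a Cauchy sequence,
  whose limit is a subgradient at \<open>y0\<close>.

  The dual function \<open>d \<psi> = (INF x. L x \<psi>)\<close> satisfies \<open>d \<psi> \<le> V y0\<close>, with equality iff
  \<open>V - \<psi>\<close> attains its minimum at \<open>y0\<close>, that is, iff \<open>\<psi>\<close> represents an element of the subdifferential.
\<close>

section \<open>Local upper bounds and a linear minorant for convex functions\<close>

lemma convex_onD_sum:
  assumes "convex_on S f" "x \<in> S" "y \<in> S" "u \<ge> 0" "v \<ge> 0" "u + v = 1"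
  shows "f (u *\<^sub>R x + v *\<^sub>R y) \<le> u * f x + v * f y"
  using assms unfolding convex_on_def by blast

text \<open>The sets \<open>F n\<close> are symmetrised sublevel sets, closed because the epigraph
  is. They cover a ball, so by Baire one of them contains a ball around some \<open>z\<close>;
  symmetry and convexity carry the bound over to a ball around \<open>y0\<close>.\<close>

lemma convex_bounded_above_near_interior:
  fixes g :: "'a::{real_normed_vector, complete_space} \<Rightarrow> real"
  assumes cvx: "convex_on D g" and clo: "closed (epigraph D g)" and y0: "y0 \<in> interior D"
  obtains r M where "r > 0" "ball y0 r \<subseteq> D" "\<And>y. y \<in> ball y0 r \<Longrightarrow> g y \<le> M"
proof -
  obtain R where R: "R > 0" "cball y0 R \<subseteq> D"
    using y0 mem_interior_cball by blast
  define F where "F = (\<lambda>n::nat. {u \<in> cball 0 R. (y0 + u, real n) \<in> epigraph D g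
                                  \<and> (y0 - u, real n) \<in> epigraph D g})"
  have Fclosed: "closed (F n)" for n
  proof -
    have "F n = cball 0 R \<inter> (\<lambda>u. (y0 + u, real n)) -` epigraph D g
                 \<inter> (\<lambda>u. (y0 - u, real n)) -` epigraph D g"
      by (auto simp: F_def)
    then show ?thesis
      by (simp, intro closed_Int closed_cball closed_vimage clo continuous_intros)
  qed
  have cover: "cball 0 R \<subseteq> (\<Union>n. F n)"
  proof
    fix u :: 'a assume u: "u \<in> cball 0 R"
    then have "y0 + u \<in> D" "y0 - u \<in> D"
      using R by (auto simp: subset_iff dist_norm)
    moreover obtain n :: nat where "max (g (y0 + u)) (g (y0 - u)) \<le> real n"
      using real_arch_simple by blast
    ultimately show "u \<in> (\<Union>n. F n)"
      using u by (auto simp: F_def mem_epigraph)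
  qed
  have "\<exists>n. interior (F n) \<noteq> {}"
  proof (rule ccontr)
    assume "\<not> ?thesis"
    then have "euclidean interior_of \<Union>(range F) = {}"
      using Fclosed
      by (intro Baire_category_alt) (auto simp: completely_metrizable_space_euclidean)
    then have "interior (\<Union>n. F n) = {}"
      by simp
    moreover have "(0::'a) \<in> interior (\<Union>n. F n)"
      using cover R ball_subset_cball[of 0 R] unfolding mem_interior by blast
    ultimately show False by blast
  qed
  then obtain n z where "z \<in> interior (F n)" by blast
  then obtain r where r: "r > 0" "ball z r \<subseteq> F n"
    by (auto simp: mem_interior)
  \<comment> \<open>\<open>y0 + u\<close> is the midpoint of \<open>y0 + (z + u)\<close> and
    \<open>y0 - (z - u)\<close>: the first point comes from \<open>z + u\<close>, the second is the
    reflection belonging to \<open>z - u\<close>.\<close>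
  have key: "y0 + u \<in> D \<and> g (y0 + u) \<le> real n" if "norm u < r" for u
  proof -
    have "z + u \<in> F n" "z - u \<in> F n"
      using r that by (auto simp: subset_iff dist_norm)
    then have 1: "y0 + (z + u) \<in> D" "g (y0 + (z + u)) \<le> n"
      "y0 - (z - u) \<in> D" "g (y0 - (z - u)) \<le> n"
      by (auto simp: F_def mem_epigraph)
    have eq: "(1/2) *\<^sub>R (y0 + (z + u)) + (1/2) *\<^sub>R (y0 - (z - u)) = y0 + u"
      by (simp add: algebra_simps flip: scaleR_add_left)
    have "convex D" using cvx by (simp add: convex_on_def)
    from convexD[OF this 1(1,3), of "1/2" "1/2"] convex_onD_sum[OF cvx 1(1,3), of "1/2" "1/2"]
    show ?thesis
      using 1 by (simp add: eq)
  qed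
  show ?thesis
  proof
    show "r > 0" by fact
    show "ball y0 r \<subseteq> D"
      using key[of "y - y0" for y] by (auto simp: dist_norm norm_minus_commute)
    show "g y \<le> real n" if "y \<in> ball y0 r" for y
      using key[of "y - y0"] that by (auto simp: dist_norm norm_minus_commute)
  qed
qed

text \<open>Beyond \<open>y0\<close>, on the ray from \<open>y\<close>, there is a point
  \<open>z\<close> at distance \<open>s = r / 2\<close> from \<open>y0\<close>, where
  \<open>g\<close> is at most \<open>M\<close>. Convexity on the segment from \<open>y\<close> to
  \<open>z\<close> yields the slope \<open>m = (M - g y0) / s\<close>.\<close>

lemma convex_bounded_above_imp_linear_minorant:
  fixes g :: "'a::real_normed_vector \<Rightarrow> real"
  assumes cvx: "convex_on D g" and r: "r > 0" "ball y0 r \<subseteq> D"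
    and M: "\<And>y. y \<in> ball y0 r \<Longrightarrow> g y \<le> M"
  obtains m where "m \<ge> 0" "\<And>y. y \<in> D \<Longrightarrow> g y0 - m * norm (y - y0) \<le> g y"
proof
  define s where "s = r / 2"
  have s: "s > 0" "s < r" using r by (auto simp: s_def)
  have y0: "g y0 \<le> M" using M r by simp
  show "(M - g y0) / s \<ge> 0" using s y0 by simp
  fix y assume y: "y \<in> D"
  show "g y0 - (M - g y0) / s * norm (y - y0) \<le> g y"
  proof (cases "y = y0")
    case False
    define d where "d = norm (y - y0)"
    have d: "d > 0" using False by (simp add: d_def)
    define z where "z = y0 - (s / d) *\<^sub>R (y - y0)"
    have z: "z \<in> ball y0 r"
      using s d by (simp add: z_def dist_norm flip: d_def)
    have "(s / (s + d)) *\<^sub>R y + (d / (s + d)) *\<^sub>R z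
        = (s / (s + d)) *\<^sub>R y + (d / (s + d)) *\<^sub>R y0 - ((d / (s + d)) * (s / d)) *\<^sub>R (y - y0)"
      by (simp add: z_def scaleR_diff_right)
    also have "(d / (s + d)) * (s / d) = s / (s + d)"
      using d by simp
    also have "(s / (s + d)) *\<^sub>R y + (d / (s + d)) *\<^sub>R y0 - (s / (s + d)) *\<^sub>R (y - y0)
        = (d / (s + d) + s / (s + d)) *\<^sub>R y0"
      by (simp add: algebra_simps)
    also have "d / (s + d) + s / (s + d) = 1"
      using s d by (simp add: add.commute flip: add_divide_distrib)
    finally have y0_eq: "(s / (s + d)) *\<^sub>R y + (d / (s + d)) *\<^sub>R z = y0"
      by simp
    have "g y0 \<le> s / (s + d) * g y + d / (s + d) * g z"
      unfolding y0_eq[symmetric] using y z r s d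
      by (intro convex_onD_sum[OF cvx]) (auto simp flip: add_divide_distrib)
    also have "\<dots> \<le> s / (s + d) * g y + d / (s + d) * M"
      using M[OF z] s d by (intro add_left_mono mult_left_mono) auto
    finally have "(s + d) * g y0 \<le> (s + d) * (s / (s + d) * g y + d / (s + d) * M)"
      using s d by (intro mult_left_mono) auto
    also have "\<dots> = s * g y + d * M"
      using s d by (simp add: distrib_left)
    finally have "(s + d) * g y0 \<le> s * g y + d * M" .
    moreover have "s * (g y0 - (M - g y0) / s * d) = (s + d) * g y0 - d * M"
      using s by (simp add: field_simps)
    ultimately have "s * (g y0 - (M - g y0) / s * d) \<le> s * g y"
      by linarith
    then show ?thesis
      using s by (simp add: d_def)
  qed simp
qed

section \<open>Proximal points of a convex function with closed epigraph\<close>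

text \<open>Divide by \<open>t\<close> and let \<open>t\<close> tend to 0. This turns minimality
  along segments into a first-order condition.\<close>

lemma real_nonneg_of_quadratic:
  fixes A B :: real
  assumes "\<And>t. 0 < t \<Longrightarrow> t \<le> 1 \<Longrightarrow> 0 \<le> t * A + t\<^sup>2 * B"
  shows "0 \<le> A"
proof -
  have "0 \<le> A + B / real (Suc n)" for n
  proof -
    have "0 \<le> (1 / real (Suc n)) * (A + B / real (Suc n))"
      using assms[of "1 / real (Suc n)"] by (simp add: power2_eq_square algebra_simps)
    then show ?thesis by (simp add: zero_le_divide_iff del: of_nat_Suc)
  qed
  moreover have "(\<lambda>n. A + B / real (Suc n)) \<longlonglongrightarrow> A + 0"
    by (intro tendsto_intros LIMSEQ_Suc lim_const_over_n)
  ultimately show ?thesis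
    by (auto intro: LIMSEQ_le_const)
qed

text \<open>Serves twice: for minimising sequences of the envelope and for the subgradients at the
  proximal points.\<close>

lemma Cauchy_of_quadratic_bound:
  fixes w :: "nat \<Rightarrow> 'a::real_normed_vector"
  assumes "\<epsilon> \<longlonglongrightarrow> 0"
    and "\<And>i j. (norm (w i - w j))\<^sup>2 \<le> C * (\<epsilon> i + \<epsilon> j)"
  shows "Cauchy w"
proof (rule CauchyI)
  fix e :: real assume e: "e > 0"
  have "(\<lambda>n. C * \<epsilon> n) \<longlonglongrightarrow> C * 0"
    by (intro tendsto_intros assms)
  then have "eventually (\<lambda>n. C * \<epsilon> n < e\<^sup>2 / 2) sequentially"
    by (rule order_tendstoD) (use e in auto)
  then obtain N where N: "\<And>n. n \<ge> N \<Longrightarrow> C * \<epsilon> n < e\<^sup>2 / 2"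
    by (auto simp: eventually_sequentially)
  have "norm (w i - w j) < e" if "i \<ge> N" "j \<ge> N" for i j
  proof -
    have "(norm (w i - w j))\<^sup>2 < e\<^sup>2"
      using assms(2)[of i j] N[OF that(1)] N[OF that(2)] by (simp add: algebra_simps)
    then show ?thesis
      using e by (simp add: power2_less_imp_less)
  qed
  then show "\<exists>N. \<forall>m\<ge>N. \<forall>n\<ge>N. norm (w m - w n) < e" by blast
qed

text \<open>The parallelogram law; its last term expresses the strong convexity of the squared
  norm.\<close>

lemma midpoint_norm_sq:
  fixes a b y0 :: "'a::real_inner"
  shows "(norm ((1/2) *\<^sub>R a + (1/2) *\<^sub>R b - y0))\<^sup>2
     = (norm (a - y0))\<^sup>2 / 2 + (norm (b - y0))\<^sup>2 / 2 - (norm (a - b))\<^sup>2 / 4"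
  unfolding power2_norm_eq_inner
  by (simp add: inner_diff_left inner_diff_right inner_add_left inner_add_right
      inner_commute field_simps)

text \<open>Strong convexity of \<open>h\<close> makes a minimising sequence Cauchy, and its limit
  \<open>w\<close> is a minimiser. The inequality is the first-order optimality condition at
  \<open>w\<close>.\<close>

lemma exists_proximal_point:
  fixes g :: "'a::{real_inner, complete_space} \<Rightarrow> real"
  assumes cvx: "convex_on D g" and clo: "closed (epigraph D g)" and ne: "D \<noteq> {}"
    and min: "\<And>y. y \<in> D \<Longrightarrow> b - m * norm (y - y0) \<le> g y" and k: "k > 0"
  obtains w where "w \<in> D" "\<And>y. y \<in> D \<Longrightarrow> g w + inner (k *\<^sub>R (y0 - w)) (y - w) \<le> g y"
proof -
  have D: "convex D" using cvx by (simp add: convex_on_def)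
  define h where "h = (\<lambda>y. g y + k / 2 * (norm (y - y0))\<^sup>2)"
  \<comment> \<open>Completing the square: the quadratic term dominates the linear decrease of the
    minorant.\<close>
  have "b - m\<^sup>2 / (2 * k) \<le> h y" if "y \<in> D" for y
  proof -
    have "0 \<le> (k * norm (y - y0) - m)\<^sup>2 / (2 * k)"
      using k by simp
    also have "\<dots> = k / 2 * (norm (y - y0))\<^sup>2 - m * norm (y - y0) + m\<^sup>2 / (2 * k)"
      using k by (simp add: power2_eq_square field_simps)
    finally show ?thesis using min[OF that] by (simp add: h_def)
  qed
  then have bdd: "bdd_below (h ` D)" by (rule bdd_belowI2)
  define I where "I = Inf (h ` D)"
  have I_le: "I \<le> h y" if "y \<in> D" for y
    using bdd that by (auto simp: I_def intro: cInf_lower)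
  define \<epsilon> where "\<epsilon> = (\<lambda>n. 1 / real (Suc n))"
  have \<epsilon>: "\<epsilon> \<longlonglongrightarrow> 0" "\<And>n. \<epsilon> n > 0"
    unfolding \<epsilon>_def by (intro LIMSEQ_Suc lim_const_over_n) simp
  have "\<exists>y\<in>D. h y < I + \<epsilon> n" for n
    using cInf_lessD[of "h ` D" "I + \<epsilon> n"] ne \<epsilon>(2)[of n] by (auto simp: I_def)
  then obtain s where s: "\<And>n. s n \<in> D" "\<And>n. h (s n) < I + \<epsilon> n" by metis
  have "(norm (s i - s j))\<^sup>2 \<le> 4 / k * (\<epsilon> i + \<epsilon> j)" for i j
  proof -
    \<comment> \<open>The gain at the midpoint: the factor \<open>k / 2\<close> of \<open>h\<close>
      times the quarter from \<open>midpoint_norm_sq\<close>. Near-minimality of \<open>s i\<close>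
      and \<open>s j\<close> leaves little room for it.\<close>
    define P where "P = k / 8 * (norm (s i - s j))\<^sup>2"
    define q where "q = (1/2) *\<^sub>R s i + (1/2) *\<^sub>R s j"
    have "q \<in> D" unfolding q_def using s D by (intro convexD) auto
    then have "I \<le> h q" by (rule I_le)
    also have "g q \<le> (1/2) * g (s i) + (1/2) * g (s j)"
      unfolding q_def using s by (intro convex_onD_sum[OF cvx]) auto
    then have "h q \<le> h (s i) / 2 + h (s j) / 2 - P"
      unfolding P_def h_def q_def midpoint_norm_sq by (simp add: field_simps)
    finally have "P \<le> (\<epsilon> i + \<epsilon> j) / 2"
      using s(2)[of i] s(2)[of j] by (simp add: field_simps)
    then show ?thesis using k by (simp add: P_def field_simps)
  qed
  from Cauchy_of_quadratic_bound[OF \<epsilon>(1) this]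
  obtain w where w: "s \<longlonglongrightarrow> w"
    using Cauchy_convergent convergent_def by blast
  \<comment> \<open>Closedness of the epigraph acts as lower semicontinuity: the bound
    \<open>h (s n) < I + \<epsilon> n\<close> passes to the limit and also gives
    \<open>w \<in> D\<close>.\<close>
  have "(w, I + 0 - k / 2 * (norm (w - y0))\<^sup>2) \<in> epigraph D g"
  proof (rule closed_sequentially[OF clo])
    show "(s n, I + \<epsilon> n - k / 2 * (norm (s n - y0))\<^sup>2) \<in> epigraph D g" for n
      using s(1)[of n] s(2)[of n] by (simp add: mem_epigraph h_def)
    show "(\<lambda>n. (s n, I + \<epsilon> n - k / 2 * (norm (s n - y0))\<^sup>2))
        \<longlonglongrightarrow> (w, I + 0 - k / 2 * (norm (w - y0))\<^sup>2)"
      by (intro tendsto_intros w \<epsilon>)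
  qed
  then have wD: "w \<in> D" and hw: "h w \<le> I"
    by (auto simp: mem_epigraph h_def)
  show ?thesis
  proof
    show "w \<in> D" by fact
    fix y assume y: "y \<in> D"
    \<comment> \<open>Compare \<open>w\<close> with points \<open>q\<close> of the segment towards
      \<open>y\<close>; after expanding the square, this expression is the coefficient of
      \<open>t\<close>.\<close>
    have "0 \<le> (g y - g w + k * inner (w - y0) (y - w))"
    proof (rule real_nonneg_of_quadratic)
      fix t :: real assume t: "0 < t" "t \<le> 1"
      define q where "q = (1 - t) *\<^sub>R w + t *\<^sub>R y"
      have "q \<in> D" unfolding q_def using wD y t D by (intro convexD) auto
      then have "h w \<le> h q" using I_le hw by (meson order_trans)
      moreover have "g q \<le> (1 - t) * g w + t * g y"
        unfolding q_def using wD y t by (intro convex_onD[OF cvx]) auto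
      moreover have "(norm (q - y0))\<^sup>2
          = (norm (w - y0))\<^sup>2 + 2 * t * inner (w - y0) (y - w) + t\<^sup>2 * (norm (y - w))\<^sup>2"
      proof -
        have q: "q - y0 = (w - y0) + t *\<^sub>R (y - w)"
          by (simp add: q_def algebra_simps)
        show ?thesis
          unfolding power2_norm_eq_inner q inner_add_left inner_add_right
          by (simp add: inner_commute[of "y - w" "w - y0"] power2_eq_square)
      qed
      ultimately show "0 \<le> t * (g y - g w + k * inner (w - y0) (y - w))
          + t\<^sup>2 * (k / 2 * (norm (y - w))\<^sup>2)"
        by (simp add: h_def field_simps)
    qed
    moreover have "inner (k *\<^sub>R (y0 - w)) (y - w) = - (k * inner (w - y0) (y - w))"
      by (simp add: inner_diff_left algebra_simps)
    ultimately show "g w + inner (k *\<^sub>R (y0 - w)) (y - w) \<le> g y"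
      by linarith
  qed
qed

section \<open>Subgradients as limits of Yosida approximations\<close>

text \<open>The estimate behind strong convergence of Yosida approximations: \<open>mono\<close> is monotonicity
  of the subdifferential for subgradients \<open>u\<close> at \<open>y0 - \<sigma> u\<close> and \<open>v\<close> at \<open>y0 - \<mu> v\<close>.\<close>

lemma yosida_estimate:
  fixes u v :: "'a::real_inner"
  assumes "0 < \<mu>" "\<mu> \<le> \<sigma>" and mono: "inner (u - v) (\<sigma> *\<^sub>R u - \<mu> *\<^sub>R v) \<le> 0"
  shows "(norm u)\<^sup>2 \<le> (norm v)\<^sup>2" "(norm (u - v))\<^sup>2 \<le> (norm v)\<^sup>2 - (norm u)\<^sup>2"
proof -
  have "2 * inner (u - v) (\<sigma> *\<^sub>R u - \<mu> *\<^sub>R v)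
      = (\<sigma> + \<mu>) * (norm (u - v))\<^sup>2 - (\<sigma> - \<mu>) * ((norm v)\<^sup>2 - (norm u)\<^sup>2)"
    by (simp add: power2_norm_eq_inner inner_diff_left inner_diff_right inner_commute algebra_simps)
  then have *: "(\<sigma> + \<mu>) * (norm (u - v))\<^sup>2 \<le> (\<sigma> - \<mu>) * ((norm v)\<^sup>2 - (norm u)\<^sup>2)"
    using mono by linarith
  show le: "(norm u)\<^sup>2 \<le> (norm v)\<^sup>2"
  \<comment> \<open>For equal parameters the right side of \<open>*\<close> vanishes, which forces
    \<open>u = v\<close>.\<close>
  proof (cases "\<mu> = \<sigma>")
    case True
    then show ?thesis using * assms by (simp add: mult_le_0_iff)
  next
    case False
    have "0 \<le> (\<sigma> + \<mu>) * (norm (u - v))\<^sup>2" using assms by simp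
    then have "0 \<le> (\<sigma> - \<mu>) * ((norm v)\<^sup>2 - (norm u)\<^sup>2)" using * by linarith
    then show ?thesis using False assms by (simp add: zero_le_mult_iff)
  qed
  \<comment> \<open>Enlarging the factor to \<open>\<sigma> + \<mu>\<close> lets it cancel, so the
    final bound is free of both parameters.\<close>
  have "(\<sigma> - \<mu>) * ((norm v)\<^sup>2 - (norm u)\<^sup>2) \<le> (\<sigma> + \<mu>) * ((norm v)\<^sup>2 - (norm u)\<^sup>2)"
    using le assms by (intro mult_right_mono) auto
  with * have "(\<sigma> + \<mu>) * (norm (u - v))\<^sup>2 \<le> (\<sigma> + \<mu>) * ((norm v)\<^sup>2 - (norm u)\<^sup>2)"
    by linarith
  then show "(norm (u - v))\<^sup>2 \<le> (norm v)\<^sup>2 - (norm u)\<^sup>2"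
    using assms by simp
qed

lemma exists_subgradient:
  fixes g :: "'a::{real_inner, complete_space} \<Rightarrow> real"
  assumes cvx: "convex_on D g" and clo: "closed (epigraph D g)" and y0: "y0 \<in> interior D"
  obtains v where "\<And>y. y \<in> D \<Longrightarrow> g y0 + inner v (y - y0) \<le> g y"
proof -
  have y0D: "y0 \<in> D" using y0 interior_subset by blast
  obtain m where m: "m \<ge> 0" "\<And>y. y \<in> D \<Longrightarrow> g y0 - m * norm (y - y0) \<le> g y"
    using convex_bounded_above_near_interior[OF cvx clo y0]
      convex_bounded_above_imp_linear_minorant[OF cvx] by metis
  \<comment> \<open>\<open>1 / \<sigma> n\<close>, that is \<open>n + 1\<close>, is the penalty
    parameter of the envelope.\<close>
  define \<sigma> where "\<sigma> = (\<lambda>n. 1 / real (Suc n))"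
  have \<sigma>: "\<sigma> \<longlonglongrightarrow> 0" "\<And>n. \<sigma> n > 0" "\<And>i j. i \<le> j \<Longrightarrow> \<sigma> j \<le> \<sigma> i"
    unfolding \<sigma>_def by (intro LIMSEQ_Suc lim_const_over_n) (auto simp: field_simps)
  have "\<exists>w\<in>D. \<forall>y\<in>D. g w + inner ((1 / \<sigma> n) *\<^sub>R (y0 - w)) (y - w) \<le> g y" for n
    using exists_proximal_point[OF cvx clo _ m(2), of "1 / \<sigma> n"] y0D \<sigma>(2)[of n]
    by (metis empty_iff zero_less_divide_1_iff)
  then obtain w where wD: "\<And>n. w n \<in> D"
    and w: "\<And>n y. y \<in> D \<Longrightarrow> g (w n) + inner ((1 / \<sigma> n) *\<^sub>R (y0 - w n)) (y - w n) \<le> g y"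
    by metis
  define v where "v = (\<lambda>n. (1 / \<sigma> n) *\<^sub>R (y0 - w n))"
  have sub: "g (w n) + inner (v n) (y - w n) \<le> g y" if "y \<in> D" for n y
    using w[OF that] by (simp add: v_def)
  have w_eq: "w n = y0 - \<sigma> n *\<^sub>R v n" for n
    using \<sigma>(2)[of n] by (simp add: v_def)
  \<comment> \<open>Test the subgradient inequality of \<open>w n\<close> at \<open>y0\<close> and
    the minorant at \<open>w n\<close>; the values of \<open>g\<close> cancel.\<close>
  have bound: "norm (v n) \<le> m" for n
  proof -
    have "inner (v n) (y0 - w n) = \<sigma> n * (norm (v n))\<^sup>2"
      by (simp add: w_eq power2_norm_eq_inner)
    moreover have "norm (w n - y0) = \<sigma> n * norm (v n)"
      using \<sigma>(2)[of n] by (simp add: w_eq)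
    ultimately have "\<sigma> n * (norm (v n))\<^sup>2 \<le> m * (\<sigma> n * norm (v n))"
      using sub[OF y0D, of n] m(2)[OF wD, of n] by simp
    then have "\<sigma> n * (norm (v n) * norm (v n)) \<le> \<sigma> n * (m * norm (v n))"
      by (simp add: power2_eq_square algebra_simps)
    then have "norm (v n) * norm (v n) \<le> m * norm (v n)"
      using \<sigma>(2)[of n] by simp
    then show ?thesis
      using m(1) by (cases "v n = 0") auto
  qed
  have mono: "inner (v i - v j) (\<sigma> i *\<^sub>R v i - \<sigma> j *\<^sub>R v j) \<le> 0" for i j
  proof -
    have "inner (v i) (w j - w i) + inner (v j) (w i - w j) \<le> 0"
      using sub[OF wD, of i j] sub[OF wD, of j i] by linarith
    then show ?thesis
      by (simp add: w_eq inner_diff_left inner_diff_right algebra_simps)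
  qed
  have yos: "(norm (v i))\<^sup>2 \<le> (norm (v j))\<^sup>2"
    "(norm (v i - v j))\<^sup>2 \<le> (norm (v j))\<^sup>2 - (norm (v i))\<^sup>2" if "i \<le> j" for i j
    using yosida_estimate[OF \<sigma>(2) \<sigma>(3)[OF that] mono] by auto
  obtain L where L: "(\<lambda>n. (norm (v n))\<^sup>2) \<longlonglongrightarrow> L" "\<And>n. (norm (v n))\<^sup>2 \<le> L"
  proof (rule incseq_convergent)
    show "incseq (\<lambda>n. (norm (v n))\<^sup>2)"
      using yos(1) by (auto simp: incseq_def)
    show "\<forall>n. (norm (v n))\<^sup>2 \<le> m\<^sup>2"
      using bound by (auto intro: power_mono)
  qed auto
  \<comment> \<open>The squared norms increase to \<open>L\<close>, so each difference of them is at
    most the distance of the smaller one from \<open>L\<close>.\<close>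
  have "(norm (v i - v j))\<^sup>2 \<le> 1 * ((L - (norm (v i))\<^sup>2) + (L - (norm (v j))\<^sup>2))" for i j
    using yos(2)[of i j] yos(2)[of j i] L(2)[of i] L(2)[of j]
    by (cases "i \<le> j") (auto simp: norm_minus_commute)
  moreover have "(\<lambda>n. L - (norm (v n))\<^sup>2) \<longlonglongrightarrow> 0"
    using tendsto_diff[OF tendsto_const[of L] L(1)] by simp
  ultimately have "Cauchy v"
    by (intro Cauchy_of_quadratic_bound)
  then obtain v' where v': "v \<longlonglongrightarrow> v'"
    using Cauchy_convergent convergent_def by blast
  have "(\<lambda>n. y0 - \<sigma> n *\<^sub>R v n) \<longlonglongrightarrow> y0 - 0 *\<^sub>R v'"
    by (intro tendsto_intros v' \<sigma>)
  then have wlim: "w \<longlonglongrightarrow> y0"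
    by (simp flip: w_eq)
  \<comment> \<open>Before the limit is taken, \<open>g (w n)\<close> is replaced by its minorant,
    which tends to \<open>g y0\<close>.\<close>
  have "g y0 + inner v' (y - y0) \<le> g y" if y: "y \<in> D" for y
  proof (rule LIMSEQ_le_const2)
    have "(\<lambda>n. g y0 - m * norm (w n - y0) + inner (v n) (y - w n))
        \<longlonglongrightarrow> g y0 - m * norm (y0 - y0) + inner v' (y - y0)"
      by (intro tendsto_intros wlim v')
    then show "(\<lambda>n. g y0 - m * norm (w n - y0) + inner (v n) (y - w n))
        \<longlonglongrightarrow> g y0 + inner v' (y - y0)"
      by simp
    have "g y0 - m * norm (w n - y0) + inner (v n) (y - w n) \<le> g y" for n
      using sub[OF y, of n] m(2)[OF wD, of n] by linarith
    then show "\<exists>N. \<forall>n\<ge>N. g y0 - m * norm (w n - y0) + inner (v n) (y - w n) \<le> g y"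
      by blast
  qed
  then show ?thesis by (rule that)
qed

section \<open>Nonemptiness of the subdifferential of an extended-valued paraconvex function\<close>

lemma lower_semicontinuous_less_sequentially:
  assumes "lower_semicontinuous h" "X \<longlonglongrightarrow> x" "C < h x"
  shows "eventually (\<lambda>n. C < h (X n)) sequentially"
proof -
  have "h x \<le> Liminf (at x) h"
    using assms by (simp add: lower_semicontinuous_def)
  then have "eventually (\<lambda>y. C < h y) (at x)"
    using assms(3) by (auto simp: le_Liminf_iff)
  \<comment> \<open>The filter \<open>at x\<close> omits \<open>x\<close> itself;
    \<open>C < h x\<close> supplies that point, since the sequence may hit \<open>x\<close>.\<close>
  then have "eventually (\<lambda>y. C < h y) (nhds x)"
    using assms(3) by (auto simp: eventually_at_filter elim!: eventually_mono)
  then show ?thesis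
    using assms(2) by (auto simp: filterlim_iff)
qed

lemma subdiff_lsc_nonempty:
  fixes V :: "'a::{real_inner, complete_space} \<Rightarrow> ereal"
  assumes proper: "proper_fun V" and lsc: "lower_semicontinuous V" and para: "paraconvex V"
    and y0: "y0 \<in> interior (effective_domain V)"
  shows "subdiff_lsc V y0 \<noteq> {}"
proof -
  obtain c where c: "c > 0" and cv: "ereal_convex (\<lambda>y. V y + ereal (c * (norm y)\<^sup>2))"
    using para by (auto simp: paraconvex_def)
  define D where "D = effective_domain V"
  \<comment> \<open>Outside \<open>D\<close> the value \<infinity> becomes 0, so \<open>V'\<close>
    and \<open>g\<close> carry information only on \<open>D\<close>; hence convexity and epigraph
    are taken relative to \<open>D\<close>.\<close>
  define V' where "V' = (\<lambda>y. real_of_ereal (V y))"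
  have V: "V y = ereal (V' y)" if "y \<in> D" for y
    using that proper by (cases "V y") (auto simp: D_def effective_domain_def proper_fun_def V'_def)
  have V_inf: "V y = \<infinity>" if "y \<notin> D" for y
    using that by (auto simp: D_def effective_domain_def)
  define g where "g = (\<lambda>y. V' y + c * (norm y)\<^sup>2)"
  have comb: "u *\<^sub>R x + v *\<^sub>R y \<in> D \<and> g (u *\<^sub>R x + v *\<^sub>R y) \<le> u * g x + v * g y"
    if "x \<in> D" "y \<in> D" "u \<ge> 0" "v \<ge> 0" "u + v = 1" for x y and u v :: real
  proof -
    let ?z = "u *\<^sub>R x + v *\<^sub>R y"
    \<comment> \<open>The right side is finite, so this one inequality gives both convexity of
      \<open>D\<close> and convexity of \<open>g\<close>.\<close>
    have le: "V ?z + ereal (c * (norm ?z)\<^sup>2) \<le> ereal (u * g x + v * g y)"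
      using cv[unfolded ereal_convex_def, rule_format, of u v x y] that by (simp add: V g_def)
    then have "?z \<in> D" using V_inf by fastforce
    then show ?thesis using le by (simp add: V g_def)
  qed
  have cvx: "convex_on D g"
    unfolding convex_on_def convex_def using comb by blast
  have clo: "closed (epigraph D g)"
    unfolding closed_sequential_limits
  proof (intro allI impI, elim conjE)
    fix X and l :: "'a \<times> real"
    assume X: "\<forall>n. X n \<in> epigraph D g" and lim: "X \<longlonglongrightarrow> l"
    obtain y t where l: "l = (y, t)" by (cases l)
    have lim1: "(\<lambda>n. fst (X n)) \<longlonglongrightarrow> y" and lim2: "(\<lambda>n. snd (X n)) \<longlonglongrightarrow> t"
      using tendsto_fst[OF lim] tendsto_snd[OF lim] by (simp_all add: l)
    have XD: "fst (X n) \<in> D" "g (fst (X n)) \<le> snd (X n)" for n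
      using X by (auto simp: epigraph_def)
    have "V y \<le> ereal (t - c * (norm y)\<^sup>2)"
    proof (rule ccontr)
      assume "\<not> ?thesis"
      then obtain C where C: "ereal (t - c * (norm y)\<^sup>2) < ereal C" "ereal C < V y"
        using ereal_dense3 by (metis ereal_dense2 not_le)
      have "eventually (\<lambda>n. ereal C < V (fst (X n))) sequentially"
        using lower_semicontinuous_less_sequentially[OF lsc lim1 C(2)] .
      then have "eventually (\<lambda>n. C \<le> snd (X n) - c * (norm (fst (X n)))\<^sup>2) sequentially"
      proof (rule eventually_mono)
        fix n assume "ereal C < V (fst (X n))"
        then show "C \<le> snd (X n) - c * (norm (fst (X n)))\<^sup>2"
          using XD[of n] by (simp add: V g_def)
      qed
      moreover have "(\<lambda>n. snd (X n) - c * (norm (fst (X n)))\<^sup>2) \<longlonglongrightarrow> t - c * (norm y)\<^sup>2"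
        by (intro tendsto_intros lim1 lim2)
      ultimately have "C \<le> t - c * (norm y)\<^sup>2"
        by (intro tendsto_lowerbound) auto
      then show False using C(1) by simp
    qed
    moreover from this have "y \<in> D" using V_inf by fastforce
    ultimately show "l \<in> epigraph D g"
      by (simp add: l mem_epigraph V g_def)
  qed
  obtain v where v: "\<And>y. y \<in> D \<Longrightarrow> g y0 + inner v (y - y0) \<le> g y"
    using exists_subgradient[OF cvx clo] y0 by (auto simp: D_def)
  have y0D: "y0 \<in> D" using y0 interior_subset by (auto simp: D_def)
  \<comment> \<open>On \<open>D\<close> this is the subgradient inequality with the quadratic terms
    moved across; off \<open>D\<close> the right side is \<infinity>.\<close>
  have "ereal (inner v (y - y0) - c * (norm y)\<^sup>2 + c * (norm y0)\<^sup>2) \<le> V y - V y0" for y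
    using v[of y] V_inf[of y] by (cases "y \<in> D") (auto simp: V y0D g_def)
  then have "(c, v) \<in> subdiff_lsc V y0"
    using c by (simp add: subdiff_lsc_def)
  then show ?thesis by blast
qed

section \<open>The dual function and its maximisers\<close>

text \<open>Shift \<open>\<psi>\<close> by a constant so that it takes the value \<open>t\<close> at
  \<open>y0\<close>. Both sides say that this shift lies below every \<open>p x\<close>, hence below
  their infimum.\<close>

lemma le_INF_lagrangian_iff:
  "ereal t \<le> (INF x. lagrangian p y0 x \<psi>)
    \<longleftrightarrow> (\<forall>y. ereal (t - \<psi> y0 + \<psi> y) \<le> optimal_value p y)"
proof -
  have "ereal t \<le> lagrangian p y0 x \<psi> \<longleftrightarrow> (\<forall>y. ereal (t - \<psi> y0 + \<psi> y) \<le> p x y)" for x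
  proof -
    have "ereal t \<le> lagrangian p y0 x \<psi> \<longleftrightarrow> (SUP y. ereal (\<psi> y) - p x y) \<le> ereal (\<psi> y0 - t)"
      unfolding lagrangian_def by (cases "SUP y. ereal (\<psi> y) - p x y") auto
    also have "\<dots> \<longleftrightarrow> (\<forall>y. ereal (\<psi> y) - p x y \<le> ereal (\<psi> y0 - t))"
      by (simp add: SUP_le_iff)
    also have "\<dots> \<longleftrightarrow> (\<forall>y. ereal (t - \<psi> y0 + \<psi> y) \<le> p x y)"
    proof (intro all_cong1)
      fix y show "ereal (\<psi> y) - p x y \<le> ereal (\<psi> y0 - t) \<longleftrightarrow> ereal (t - \<psi> y0 + \<psi> y) \<le> p x y"
        by (cases "p x y") auto
    qed
    finally show ?thesis .
  qed
  then show ?thesis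
    by (auto simp: optimal_value_def le_INF_iff)
qed

text \<open>Weak duality: keep only \<open>y = y0\<close> in the supremum.\<close>

lemma lagrangian_le: "lagrangian p y0 x \<psi> \<le> p x y0"
proof -
  have "ereal (\<psi> y0) - p x y0 \<le> (SUP y. ereal (\<psi> y) - p x y)"
    by (rule SUP_upper) simp
  then show ?thesis
    unfolding lagrangian_def
    by (cases "p x y0"; cases "SUP y. ereal (\<psi> y) - p x y") auto
qed

lemma INF_lagrangian_le: "(INF x. lagrangian p y0 x \<psi>) \<le> optimal_value p y0"
  unfolding optimal_value_def by (intro INF_mono) (auto intro: lagrangian_le)

text \<open>By weak duality, equality means that \<open>t\<close> is a lower bound of the dual
  value; the shifted minorant from \<open>le_INF_lagrangian_iff\<close> is then the subgradient
  inequality, in which \<open>c\<close> cancels.\<close>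

lemma mem_subdiff_lsc_iff:
  assumes "optimal_value p y0 = ereal t"
  shows "(a, v) \<in> subdiff_lsc (optimal_value p) y0
    \<longleftrightarrow> a \<ge> 0 \<and> (INF x. lagrangian p y0 x (psi_fun a v c)) = optimal_value p y0"
proof -
  have "(INF x. lagrangian p y0 x (psi_fun a v c)) = optimal_value p y0
      \<longleftrightarrow> ereal t \<le> (INF x. lagrangian p y0 x (psi_fun a v c))"
    using INF_lagrangian_le[of p y0 "psi_fun a v c"] assms by auto
  also have "\<dots> \<longleftrightarrow> (\<forall>y. ereal (t - psi_fun a v c y0 + psi_fun a v c y) \<le> optimal_value p y)"
    by (rule le_INF_lagrangian_iff)
  also have "\<dots> \<longleftrightarrow> (\<forall>y. ereal (inner v (y - y0) - a * (norm y)\<^sup>2 + a * (norm y0)\<^sup>2)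
      \<le> optimal_value p y - optimal_value p y0)"
  proof (intro all_cong1)
    fix y
    show "ereal (t - psi_fun a v c y0 + psi_fun a v c y) \<le> optimal_value p y
      \<longleftrightarrow> ereal (inner v (y - y0) - a * (norm y)\<^sup>2 + a * (norm y0)\<^sup>2)
        \<le> optimal_value p y - optimal_value p y0"
      by (cases "optimal_value p y") (auto simp: assms psi_fun_def inner_diff_right)
  qed
  finally show ?thesis by (auto simp: subdiff_lsc_def)
qed

theorem theorem8:
  fixes f :: "'x::{real_inner, complete_space} \<Rightarrow> ereal"
    and p :: "'x \<Rightarrow> 'y::{real_inner, complete_space} \<Rightarrow> ereal"
    and y0 :: 'y
  assumes "proper_fun f"
    and "\<And>x. p x y0 = f x"
    and "\<And>x. Psi_lsc_convex_at (p x) y0"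
    and "proper_fun (optimal_value p)"
    and "lower_semicontinuous (optimal_value p)"
    and "paraconvex (optimal_value p)"
    and "y0 \<in> interior (effective_domain (optimal_value p))"
  shows "(INF x. f x) = (SUP \<psi>\<in>Psi_lsc. INF x. lagrangian p y0 x \<psi>)
    \<and> (SUP \<psi>\<in>Psi_lsc. INF x. lagrangian p y0 x \<psi>)
        = (INF x. SUP \<psi>\<in>Psi_lsc. lagrangian p y0 x \<psi>)
    \<and> dual_solutions p y0 \<noteq> {}
    \<and> dual_solution_pairs p y0 = subdiff_lsc (optimal_value p) y0"
proof -
  let ?V = "optimal_value p" and ?d = "\<lambda>\<psi>. INF x. lagrangian p y0 x \<psi>"
  have "?V y0 < \<infinity>" "?V y0 > -\<infinity>"
    using assms(4,7) interior_subset by (auto simp: proper_fun_def effective_domain_def)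
  then obtain t where t: "?V y0 = ereal t"
    by (cases "?V y0") auto
  have inf_f: "(INF x. f x) = ?V y0"
    by (simp add: optimal_value_def assms(2))
  obtain a v where av: "(a, v) \<in> subdiff_lsc ?V y0"
    using subdiff_lsc_nonempty[OF assms(4-7)] by auto
  have psi: "psi_fun b u c \<in> Psi_lsc" if "b \<ge> 0" for b c and u :: 'y
    using that by (auto simp: Psi_lsc_def)
  have opt: "psi_fun a v 0 \<in> Psi_lsc" "?d (psi_fun a v 0) = ?V y0"
    using av mem_subdiff_lsc_iff[OF t, of a v 0] psi[of a v 0] by auto
  have dual: "(SUP \<psi>\<in>Psi_lsc. ?d \<psi>) = ?V y0"
  proof (rule antisym)
    show "(SUP \<psi>\<in>Psi_lsc. ?d \<psi>) \<le> ?V y0"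
      by (intro SUP_least INF_lagrangian_le)
    show "?V y0 \<le> (SUP \<psi>\<in>Psi_lsc. ?d \<psi>)"
      using SUP_upper[OF opt(1), of ?d] opt(2) by simp
  qed
  \<comment> \<open>The upper bound is weak duality for each \<open>x\<close>; the lower one keeps
    only the optimal \<open>psi_fun a v 0\<close> in the inner supremum.\<close>
  have "(INF x. SUP \<psi>\<in>Psi_lsc. lagrangian p y0 x \<psi>) = ?V y0"
  proof (rule antisym)
    show "(INF x. SUP \<psi>\<in>Psi_lsc. lagrangian p y0 x \<psi>) \<le> ?V y0"
      unfolding optimal_value_def by (intro INF_mono) (auto intro: SUP_least lagrangian_le)
    have "?d (psi_fun a v 0) \<le> (INF x. SUP \<psi>\<in>Psi_lsc. lagrangian p y0 x \<psi>)"
      by (intro INF_mono) (auto intro: SUP_upper opt)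
    then show "?V y0 \<le> (INF x. SUP \<psi>\<in>Psi_lsc. lagrangian p y0 x \<psi>)"
      by (simp add: opt(2))
  qed
  moreover have "psi_fun a v 0 \<in> dual_solutions p y0"
    using opt dual by (simp add: dual_solutions_def)
  \<comment> \<open>The equivalence holds for every constant \<open>c\<close>, so it fits the
    existential in \<open>dual_solution_pairs\<close>.\<close>
  moreover have "(b, u) \<in> dual_solution_pairs p y0 \<longleftrightarrow> (b, u) \<in> subdiff_lsc ?V y0" for b u
    using psi[of b u] mem_subdiff_lsc_iff[OF t, of b u]
    by (auto simp: dual_solution_pairs_def dual_solutions_def dual)
  ultimately show ?thesis
    using inf_f dual by auto
qed

end
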